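(* Let $s,t$ be real numbers with $s\neq0$, $t\neq0$, and let $d\geq 0$ be an integer. For all integers $n\geq1$, \[ \genfrac{\{}{\}}{0pt}{}{n+d}{d+1}_{s,t}=\sum_{k=1}^{n}\varphi_{s,t}^{(d+1)(n-k)}\,\varphi_{s,t}^{\prime\,(k-1)}\genfrac{\{}{\}}{0pt}{}{k+d-1}{d}_{s,t} \qquad\text{and}\qquad \genfrac{\{}{\}}{0pt}{}{n+d}{d+1}_{s,t}=\sum_{k=1}^{n}\varphi_{s,t}^{\prime\,(d+1)(n-k)}\,\varphi_{s,t}^{k-1}\genfrac{\{}{\}}{0pt}{}{k+d-1}{d}_{s,t}. \]
   Context: The generalized Fibonacci polynomials $\{n\}_{s,t}$ are defined by $\{0\}_{s,t}=0$, $\{1\}_{s,t}=1$, $\{n+2\}_{s,t}=s\{n+1\}_{s,t}+t\{n\}_{s,t}$. Set $\varphi_{s,t}=\frac{s+\sqrt{s^2+4t}}{2}$ and $\varphi'_{s,t}=\frac{s-\sqrt{s^2+4t}}{2}=s-\varphi_{s,t}=-t/\varphi_{s,t}$; exponents on $\varphi'_{s,t}$ denote ordinary powers. The generalized factorial is $\{m\}_{s,t}!=\{1\}_{s,t}\{2\}_{s,t}\cdots\{m\}_{s,t}$ (with $\{0\}_{s,t}!=1$). For integers $n\geq1$, $d\geq0$, the $n$-th generalized simplicial $d$-polytopic number is \[\genfrac{\{}{\}}{0pt}{}{n+d-1}{d}_{s,t}=\frac{\{n\}_{s,t}\{n+1\}_{s,t}\cdots\{n+d-1\}_{s,t}}{\{d\}_{s,t}!}\]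 (the empty product for $d=0$ equals $1$); it coincides with the fibonomial coefficient $\frac{\{n+d-1\}_{s,t}!}{\{d\}_{s,t}!\{n-1\}_{s,t}!}$. Denominators $\{k\}_{s,t}$ appearing are assumed nonzero. *)

theory Defs
  imports Complex_Main
begin

fun gfib :: "real \<Rightarrow> real \<Rightarrow> nat \<Rightarrow> real" where
  "gfib s t 0 = 0"
| "gfib s t (Suc 0) = 1"
| "gfib s t (Suc (Suc n)) = s * gfib s t (Suc n) + t * gfib s t n"

text \<open>The discriminant \<open>s\<^sup>2 + 4 * t\<close> may be negative, so the roots are taken in the
  complex numbers, with the principal square root.\<close>

definition gphi :: "real \<Rightarrow> real \<Rightarrow> complex" where
  "gphi s t = (complex_of_real s + csqrt (complex_of_real (s\<^sup>2 + 4 * t))) / 2"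

definition gphi' :: "real \<Rightarrow> real \<Rightarrow> complex" where
  "gphi' s t = (complex_of_real s - csqrt (complex_of_real (s\<^sup>2 + 4 * t))) / 2"

definition gfib_fact :: "real \<Rightarrow> real \<Rightarrow> nat \<Rightarrow> real" where
  "gfib_fact s t m = (\<Prod>i=1..m. gfib s t i)"

text \<open>\<open>polytopic s t n d\<close> is the \<open>n\<close>-th generalized simplicial \<open>d\<close>-polytopic number, usually
  displayed as a fibonomial coefficient with upper entry \<open>n + d - 1\<close> and lower entry \<open>d\<close>;
  it is meant for \<open>n \<ge> 1\<close>.\<close>

definition polytopic :: "real \<Rightarrow> real \<Rightarrow> nat \<Rightarrow> nat \<Rightarrow> real" where
  "polytopic s t n d = (\<Prod>i<d. gfib s t (n + i)) / gfib_fact s t d"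

end

(* For roots a, b of x^2 = s x + t, in either order, the addition formula
   F(n+m) = a^m F(n) + b^n F(m) with m = d + 1 gives the Pascal-type rule
   P(n+1,d+1) = a^(d+1) P(n,d+1) + b^n P(n+1,d).  As P(0,d+1) = 0, unrolling it in n
   gives the sum. *)
theory Submission
  imports Defs
begin

lemma gphi_add: "gphi s t + gphi' s t = of_real s"
  by (simp add: gphi_def gphi'_def field_simps)

lemma gphi_mult: "gphi s t * gphi' s t = - of_real t"
proof -
  have "gphi s t * gphi' s t = ((of_real s)\<^sup>2 - (csqrt (of_real (s\<^sup>2 + 4 * t)))\<^sup>2) / 4"
    by (simp add: gphi_def gphi'_def field_simps power2_eq_square del: power2_csqrt)
  also have "\<dots> = - of_real t"
    by (simp only: power2_csqrt) simp
  finally show ?thesis .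
qed

text \<open>The defect \<open>F(n+1) - a F(n)\<close> is geometric with ratio \<open>b\<close>:
  since \<open>s - a = b\<close> and \<open>t = - a b\<close>, the recurrence gives
  \<open>F(n+2) - a F(n+1) = b (F(n+1) - a F(n))\<close>.\<close>

lemma gfib_Suc:
  assumes "a + b = complex_of_real s" "a * b = - complex_of_real t"
  shows "of_real (gfib s t (Suc n)) = a * of_real (gfib s t n) + b ^ n"
proof (induction n)
  case (Suc n)
  have t: "complex_of_real t = - (a * b)"
    using assms(2) by simp
  show ?case
    using Suc by (simp add: assms(1)[symmetric] t algebra_simps)
qed simp

text \<open>As functions of \<open>m\<close>, both sides obey the recurrence of
  \<open>gfib_Suc\<close>: each step multiplies by \<open>a\<close> and adds
  \<open>b ^ (n + m) = b ^ n * b ^ m\<close>.\<close>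

lemma gfib_add:
  assumes "a + b = complex_of_real s" "a * b = - complex_of_real t"
  shows "of_real (gfib s t (n + m)) = a ^ m * of_real (gfib s t n) + b ^ n * of_real (gfib s t m)"
proof (induction m)
  case (Suc m)
  show ?case
    using Suc gfib_Suc[OF assms, of "n + m"] gfib_Suc[OF assms, of m]
    by (simp add: algebra_simps power_add)
qed simp

lemma polytopic_Suc:
  assumes "a + b = complex_of_real s" "a * b = - complex_of_real t"
    and "gfib s t (Suc d) \<noteq> 0"
  shows "of_real (polytopic s t (Suc n) (Suc d)) =
    a ^ Suc d * of_real (polytopic s t n (Suc d)) + b ^ n * of_real (polytopic s t (Suc n) d)"
proof -
  \<comment> \<open>\<open>Q\<close> is common to the numerators of all three polytopic numbers;
    what remains is the addition formula for index \<open>n + Suc d\<close>.\<close>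
  define Q where "Q = (\<Prod>i<d. gfib s t (Suc n + i))"
  have 1: "(\<Prod>i<Suc d. gfib s t (Suc n + i)) = Q * gfib s t (n + Suc d)"
    by (simp add: Q_def)
  have 2: "(\<Prod>i<Suc d. gfib s t (n + i)) = gfib s t n * Q"
    by (simp add: Q_def prod.lessThan_Suc_shift del: prod.lessThan_Suc)
  have 3: "gfib_fact s t (Suc d) = gfib_fact s t d * gfib s t (Suc d)"
    by (simp add: gfib_fact_def)
  show ?thesis
    unfolding polytopic_def 1 2 3 Q_def[symmetric] of_real_divide of_real_mult
      gfib_add[OF assms(1,2), of n "Suc d"]
    \<comment> \<open>If \<open>gfib_fact s t d\<close> is 0, so is
      \<open>gfib_fact s t (Suc d)\<close>, and every quotient is 0 by the convention
      \<open>x / 0 = 0\<close>.\<close>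
    using assms(3) by (cases "gfib_fact s t d = 0") (simp_all add: field_simps)
qed

lemma polytopic_eq_sum:
  assumes "a + b = complex_of_real s" "a * b = - complex_of_real t"
    and "gfib s t (Suc d) \<noteq> 0"
  shows "of_real (polytopic s t n (Suc d)) =
    (\<Sum>k=1..n. a ^ (Suc d * (n - k)) * b ^ (k - 1) * of_real (polytopic s t k d))"
proof (induction n)
  case 0
  show ?case
    \<comment> \<open>The product over \<open>i < Suc d\<close> contains the factor
      \<open>gfib s t 0 = 0\<close> at \<open>i = 0\<close>.\<close>
    by (simp add: polytopic_def prod.lessThan_Suc_shift del: prod.lessThan_Suc)
next
  case (Suc n)
  have "a ^ Suc d * (\<Sum>k=1..n. a ^ (Suc d * (n - k)) * b ^ (k - 1) * of_real (polytopic s t k d)) =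
      (\<Sum>k=1..n. a ^ (Suc d * (Suc n - k)) * b ^ (k - 1) * of_real (polytopic s t k d))"
    unfolding sum_distrib_left
  proof (intro sum.cong refl)
    fix k assume "k \<in> {1..n}"
    \<comment> \<open>The bound \<open>k \<le> n\<close> keeps the subtraction from truncating, so
      \<open>Suc n - k = Suc (n - k)\<close>.\<close>
    then have "a ^ (Suc d * (Suc n - k)) = a ^ Suc d * a ^ (Suc d * (n - k))"
      by (simp only: power_mult Suc_diff_le atLeastAtMost_iff power_Suc)
    then show "a ^ Suc d * (a ^ (Suc d * (n - k)) * b ^ (k - 1) * of_real (polytopic s t k d)) =
        a ^ (Suc d * (Suc n - k)) * b ^ (k - 1) * of_real (polytopic s t k d)"
      by (simp only: mult.assoc)
  qed
  \<comment> \<open>The new summand \<open>k = Suc n\<close> has \<open>a\<close>-exponent 0 and is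
    the \<open>b ^ n\<close> term of \<open>polytopic_Suc\<close>.\<close>
  then show ?case
    by (simp add: polytopic_Suc[OF assms] Suc.IH del: power_Suc mult_Suc)
qed

theorem theorem1:
  fixes s t :: real and d n :: nat
  assumes "s \<noteq> 0" and "t \<noteq> 0"
    and "\<And>k. 1 \<le> k \<Longrightarrow> k \<le> d + 1 \<Longrightarrow> gfib s t k \<noteq> 0"
    and "n \<ge> 1"
  shows "complex_of_real (polytopic s t n (d + 1)) =
           (\<Sum>k=1..n. gphi s t ^ ((d + 1) * (n - k)) * gphi' s t ^ (k - 1)
                      * complex_of_real (polytopic s t k d)) \<and>
         complex_of_real (polytopic s t n (d + 1)) =
           (\<Sum>k=1..n. gphi' s t ^ ((d + 1) * (n - k)) * gphi s t ^ (k - 1)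
                      * complex_of_real (polytopic s t k d))"
proof -
  have nz: "gfib s t (Suc d) \<noteq> 0"
    using assms(3)[of "Suc d"] by simp
  \<comment> \<open>Sum and product are symmetric in the roots, so exchanging them yields the second
    identity.\<close>
  have swap: "gphi' s t + gphi s t = of_real s" "gphi' s t * gphi s t = - of_real t"
    using gphi_add[of s t] gphi_mult[of s t] by (simp_all add: ac_simps)
  show ?thesis
    using polytopic_eq_sum[OF gphi_add gphi_mult nz, of n] polytopic_eq_sum[OF swap nz, of n]
    unfolding Suc_eq_plus1 by blast
qed

end
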